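(* Let $\mathcal G=\{G_1,\dots,G_\ell\}$ be a finite family of pairwise homomorphically incomparable oriented graphs, each of which is a core, such that: (a) for every $G\in\mathcal G$, there is no homomorphism $\prod_{H\in\mathcal G,\,H\neq G}H\to G$, and there is a homomorphism $\prod_{H\in\mathcal G,\,H\ne G}H\to G^{\triangleleft}$; (b) $\mathcal G$ is an orthogonal family, i.e. for every $G\in\mathcal G$, every homomorphism $\prod_{H\in\mathcal G}H\to G$ is surjective on vertices. Then $\prod_{G\in\mathcal G}G^{\triangleleft}$ is a core.
   Context: All digraphs are finite, without loops and without parallel arcs; a pair of opposite arcs (a digon) is allowed in a digraph. An oriented graph is a digraph with no digon. A homomorphism $G\to H$ is a map $V(G)\to V(H)$ sending arcs to arcs (preserving direction). Two digraphs are incomparable if there is no homomorphism from either one to the other. All products are tensor products: the vertex set is the Cartesian product, and there is an arc from $(u_i)_i$ to $(v_i)_i$ iff $u_i\to v_i$ is an arc in every coordinate $i$. A digraph is a core if its only retract (endomorphism $\phi$ with $\phi^2=\phi$) is the identity (equivalently, it is not homomorphically equivalent to any digraph with fewer vertices). The cone $G^{\triangleleft}$ of a digraph $G$ is obtained from $G$ by adding one new vertex (the apex), joined by arcs in both directions to every vertex of $G$. *)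

theory Defs
  imports "Graph_Theory.Pair_Digraph" "HOL-Library.FuncSet"
begin

text \<open>
  Finite loopless digraphs without parallel arcs are the instances of \<^locale>\<open>pair_digraph\<close>.
  Maps between vertex sets are total functions on the ambient type; only their values on the
  vertices matter.
\<close>

locale oriented_graph = pair_digraph +
  assumes no_digon: "(u, v) \<in> parcs G \<Longrightarrow> (v, u) \<notin> parcs G"

definition digraph_hom :: "'a pair_pre_digraph \<Rightarrow> 'b pair_pre_digraph \<Rightarrow> ('a \<Rightarrow> 'b) \<Rightarrow> bool" where
  "digraph_hom G H f \<longleftrightarrow>
     f \<in> pverts G \<rightarrow> pverts H \<and> (\<forall>u v. (u, v) \<in> parcs G \<longrightarrow> (f u, f v) \<in> parcs H)"

definition hom_to :: "'a pair_pre_digraph \<Rightarrow> 'b pair_pre_digraph \<Rightarrow> bool" where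
  "hom_to G H \<longleftrightarrow> (\<exists>f. digraph_hom G H f)"

definition incomparable :: "'a pair_pre_digraph \<Rightarrow> 'b pair_pre_digraph \<Rightarrow> bool" where
  "incomparable G H \<longleftrightarrow> \<not> hom_to G H \<and> \<not> hom_to H G"

definition is_core :: "'a pair_pre_digraph \<Rightarrow> bool" where
  "is_core G \<longleftrightarrow>
     (\<forall>\<phi>. digraph_hom G G \<phi> \<and> (\<forall>v\<in>pverts G. \<phi> (\<phi> v) = \<phi> v) \<longrightarrow> (\<forall>v\<in>pverts G. \<phi> v = v))"

text \<open>
  The use of \<^const>\<open>PiE\<close> makes every vertex of the product a function that is \<^const>\<open>undefined\<close>
  outside of \<open>I\<close>, so that distinct vertices differ in some coordinate in \<open>I\<close>.
  The product over the empty index set is a single vertex with a loop.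
\<close>

definition tensor_prod :: "'i set \<Rightarrow> ('i \<Rightarrow> 'a pair_pre_digraph) \<Rightarrow> ('i \<Rightarrow> 'a) pair_pre_digraph" where
  "tensor_prod I G =
     \<lparr> pverts = (\<Pi>\<^sub>E i\<in>I. pverts (G i)),
       parcs = {(u, v). u \<in> (\<Pi>\<^sub>E i\<in>I. pverts (G i)) \<and> v \<in> (\<Pi>\<^sub>E i\<in>I. pverts (G i)) \<and>
                        (\<forall>i\<in>I. (u i, v i) \<in> parcs (G i))} \<rparr>"

text \<open>The apex of the cone is \<^const>\<open>None\<close>.\<close>

definition cone :: "'a pair_pre_digraph \<Rightarrow> 'a option pair_pre_digraph" where
  "cone G =
     \<lparr> pverts = insert None (Some ` pverts G),
       parcs = {(Some u, Some v) | u v. (u, v) \<in> parcs G} \<union>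
               {(None, Some v) | v. v \<in> pverts G} \<union> {(Some v, None) | v. v \<in> pverts G} \<rparr>"

lemma pair_digraph_cone:
  assumes "pair_digraph G"
  shows "pair_digraph (cone G)"
proof -
  interpret pair_digraph G by fact
  have fin: "finite (pverts (cone G))"
    using pair_finite_verts by (simp add: cone_def)
  have sub: "parcs (cone G) \<subseteq> pverts (cone G) \<times> pverts (cone G)"
    by (auto simp: cone_def dest: in_arcsD1 in_arcsD2)
  have "finite (parcs (cone G))"
    using finite_subset[OF sub] fin by blast
  then show ?thesis
    using fin sub pair_no_loops
    by unfold_locales (auto simp: cone_def dest: in_arcsD1 in_arcsD2)
qed

lemma pair_digraph_tensor_prod:
  assumes "finite I" "I \<noteq> {}" and G: "\<And>i. i \<in> I \<Longrightarrow> pair_digraph (G i)"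
  shows "pair_digraph (tensor_prod I G)"
proof -
  have fin: "finite (pverts (tensor_prod I G))"
    using assms pair_fin_digraph.pair_finite_verts pair_digraph.axioms(1)
    by (fastforce simp: tensor_prod_def intro!: finite_PiE)
  have sub: "parcs (tensor_prod I G) \<subseteq> pverts (tensor_prod I G) \<times> pverts (tensor_prod I G)"
    by (auto simp: tensor_prod_def)
  have "finite (parcs (tensor_prod I G))"
    using finite_subset[OF sub] fin by blast
  moreover have "u \<noteq> v" if uv: "(u, v) \<in> parcs (tensor_prod I G)" for u v
  proof -
    obtain i where i: "i \<in> I" using \<open>I \<noteq> {}\<close> by blast
    interpret pair_digraph "G i" using G i .
    show ?thesis using uv i pair_no_loops by (fastforce simp: tensor_prod_def)
  qed
  ultimately show ?thesis
    using fin sub by unfold_locales (auto simp del: split_paired_All)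
qed

end

theory Submission
  imports Defs
begin

text \<open>
  Let \<open>\<phi>\<close> be a retraction of the product \<open>P\<close> of the cones. Two vertices of \<open>P\<close> form a digon iff
  their sets of apex coordinates are complementary, since the \<open>G i\<close> have no digons. So the apex set
  of \<open>\<phi> u\<close> depends only on that of \<open>u\<close>, and the induced map on subsets of \<open>I\<close> preserves complements
  and disjointness. The homomorphisms from the product of the other factors to the cone over \<open>G i\<close>
  force \<open>i\<close> into the image of \<open>{i}\<close>, so the induced map is the identity.

  Hence \<open>\<phi>\<close> acts on the vertices all of whose coordinates except the \<open>i\<close>-th are apices by a self-map
  \<open>f\<close> of \<open>G i\<close>. By orthogonality and idempotence every vertex of \<open>G i\<close> is the \<open>i\<close>-th coordinate of
  a fixed apex-free vertex; this makes \<open>f\<close> an idempotent endomorphism, i.e. the identity.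
  In a core no vertex dominates another one, so a vertex with enough neighbours whose \<open>i\<close>-th
  coordinate \<open>\<phi>\<close> preserves has its \<open>i\<close>-th coordinate preserved as well. Three applications of this
  spread the fixed points to all of \<open>P\<close>.
\<close>

section \<open>Arcs and vertices of cones and tensor products\<close>

lemma cone_arc_simps [simp]:
  "(None, None) \<notin> parcs (cone G)"
  "(None, Some v) \<in> parcs (cone G) \<longleftrightarrow> v \<in> pverts G"
  "(Some v, None) \<in> parcs (cone G) \<longleftrightarrow> v \<in> pverts G"
  "(Some u, Some v) \<in> parcs (cone G) \<longleftrightarrow> (u, v) \<in> parcs G"
  by (auto simp: cone_def)

lemma cone_vert_simps [simp]:
  "None \<in> pverts (cone G)"
  "Some v \<in> pverts (cone G) \<longleftrightarrow> v \<in> pverts G"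
  by (auto simp: cone_def)

text \<open>The apex forms a digon with every other vertex and has no loop, and two vertices of
  \<open>G\<close> itself never form a digon.\<close>

lemma oriented_cone_digon_iff:
  assumes "oriented_graph G" "a \<in> pverts (cone G)" "b \<in> pverts (cone G)"
  shows "(a, b) \<in> parcs (cone G) \<and> (b, a) \<in> parcs (cone G) \<longleftrightarrow> (a = None \<longleftrightarrow> b \<noteq> None)"
proof -
  interpret oriented_graph G by fact
  show ?thesis
    using assms(2,3) no_digon by (cases a; cases b) auto
qed

lemma tensor_prod_vertI:
  "(\<And>i. i \<in> I \<Longrightarrow> f i \<in> pverts (G i)) \<Longrightarrow> restrict f I \<in> pverts (tensor_prod I G)"
  by (auto simp: tensor_prod_def)

lemma tensor_prod_vertD:
  "u \<in> pverts (tensor_prod I G) \<Longrightarrow> i \<in> I \<Longrightarrow> u i \<in> pverts (G i)"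
  by (auto simp: tensor_prod_def)

lemma tensor_prod_arc_iff:
  "(u, v) \<in> parcs (tensor_prod I G) \<longleftrightarrow>
     u \<in> pverts (tensor_prod I G) \<and> v \<in> pverts (tensor_prod I G) \<and>
     (\<forall>i\<in>I. (u i, v i) \<in> parcs (G i))"
  by (auto simp: tensor_prod_def)

lemma tensor_prod_vert_eqI:
  assumes "u \<in> pverts (tensor_prod I G)" "v \<in> pverts (tensor_prod I G)"
    and "\<And>i. i \<in> I \<Longrightarrow> u i = v i"
  shows "u = v"
  using assms by (auto simp: tensor_prod_def intro: PiE_ext)

section \<open>Cores and incomparable digraphs\<close>

text \<open>Folding \<open>x\<close> onto \<open>x'\<close> and fixing everything else is a
  retraction; the absence of a loop at \<open>x\<close> ensures that at most one end of an arc
  moves.\<close>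

lemma core_dominating_vertex_eq:
  assumes G: "pair_digraph G" "is_core G" and x: "x \<in> pverts G" and x': "x' \<in> pverts G"
    and out: "\<And>y. (x, y) \<in> parcs G \<Longrightarrow> (x', y) \<in> parcs G"
    and inn: "\<And>y. (y, x) \<in> parcs G \<Longrightarrow> (y, x') \<in> parcs G"
  shows "x' = x"
proof -
  interpret pair_digraph G by fact
  define r where "r = id(x := x')"
  have "digraph_hom G G r"
    unfolding digraph_hom_def r_def using x' out inn pair_no_loops by fastforce
  moreover have "\<forall>v\<in>pverts G. r (r v) = r v" by (auto simp: r_def)
  ultimately have "r x = x" using G(2) x unfolding is_core_def by blast
  then show ?thesis by (simp add: r_def)
qed

text \<open>Vertices with an out-neighbour go to \<open>a\<close>, all others to \<open>b\<close>;
  by \<open>no_middle\<close> the head of an arc always goes to \<open>b\<close>.\<close>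

lemma hom_to_digraph_with_arc:
  assumes "pair_digraph H" "(a, b) \<in> parcs H"
    and no_middle: "\<And>x y z. (x, y) \<in> parcs G \<Longrightarrow> (y, z) \<notin> parcs G"
  shows "hom_to G H"
proof -
  interpret H: pair_digraph H by fact
  define f where "f x = (if \<exists>y. (x, y) \<in> parcs G then a else b)" for x
  have "digraph_hom G H f"
    unfolding digraph_hom_def f_def
    using assms(2) no_middle H.in_arcsD1 H.in_arcsD2 by fastforce
  then show ?thesis unfolding hom_to_def by blast
qed

lemma hom_to_arcless:
  assumes "parcs G = {}" "pverts G = {} \<or> pverts H \<noteq> {}"
  shows "hom_to G H"
proof -
  have "digraph_hom G H (\<lambda>_. SOME y. y \<in> pverts H)"
    using assms by (auto simp: digraph_hom_def some_in_eq)
  then show ?thesis unfolding hom_to_def by blast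
qed

text \<open>Without a walk of length two \<open>G\<close> would map to a single arc of
  \<open>H\<close>. Such an arc exists, since an arcless \<open>H\<close> would map to the nonempty
  \<open>G\<close>.\<close>

lemma incomparable_middle_vertex:
  assumes GH: "pair_digraph G" "pair_digraph H" and inc: "incomparable G H"
  obtains x y z where "(x, y) \<in> parcs G" "(y, z) \<in> parcs G"
proof -
  interpret G: pair_digraph G by fact
  have "pverts G \<noteq> {}"
    using inc hom_to_arcless[of G H] G.in_arcsD1 by (force simp: incomparable_def)
  then have "parcs H \<noteq> {}"
    using inc hom_to_arcless[of H G] by (auto simp: incomparable_def)
  then obtain a b where "(a, b) \<in> parcs H" by auto
  then show thesis
    using that hom_to_digraph_with_arc[OF GH(2), of a b G] inc
    unfolding incomparable_def by blast
qed

section \<open>Endomorphisms of the product of cones preserve apex sets\<close>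

locale cone_product_endo =
  fixes I :: "'i set" and G :: "'i \<Rightarrow> 'a pair_pre_digraph"
    and \<phi> :: "('i \<Rightarrow> 'a option) \<Rightarrow> ('i \<Rightarrow> 'a option)"
    and p m n :: "'i \<Rightarrow> 'a"
  assumes oriented: "\<And>i. i \<in> I \<Longrightarrow> oriented_graph (G i)"
    and arc_pm: "\<And>i. i \<in> I \<Longrightarrow> (p i, m i) \<in> parcs (G i)"
    and arc_mn: "\<And>i. i \<in> I \<Longrightarrow> (m i, n i) \<in> parcs (G i)"
    and endo: "digraph_hom (tensor_prod I (\<lambda>i. cone (G i))) (tensor_prod I (\<lambda>i. cone (G i))) \<phi>"
    and not_hom_others: "\<And>i. i \<in> I \<Longrightarrow> \<not> hom_to (tensor_prod (I - {i}) G) (G i)"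
    and hom_others_cone: "\<And>i. i \<in> I \<Longrightarrow> hom_to (tensor_prod (I - {i}) G) (cone (G i))"
begin

abbreviation "P \<equiv> tensor_prod I (\<lambda>i. cone (G i))"

definition apexes :: "('i \<Rightarrow> 'a option) \<Rightarrow> 'i set" where
  "apexes u = {i \<in> I. u i = None}"

lemma pair_digraph_G: "i \<in> I \<Longrightarrow> pair_digraph (G i)"
  using oriented oriented_graph.axioms(1) by blast

lemma arc_verts: "i \<in> I \<Longrightarrow> (x, y) \<in> parcs (G i) \<Longrightarrow> x \<in> pverts (G i) \<and> y \<in> pverts (G i)"
  using pair_digraph_G pair_digraph.axioms(1) pair_fin_digraph.axioms(1)
    pair_wf_digraph.in_arcsD1 pair_wf_digraph.in_arcsD2 by metis

lemma pmn_verts [simp]: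
  "i \<in> I \<Longrightarrow> p i \<in> pverts (G i)" "i \<in> I \<Longrightarrow> m i \<in> pverts (G i)" "i \<in> I \<Longrightarrow> n i \<in> pverts (G i)"
  using arc_verts arc_pm arc_mn by blast+

lemma endo_vert: "u \<in> pverts P \<Longrightarrow> \<phi> u \<in> pverts P"
  using endo by (auto simp: digraph_hom_def)

lemma endo_arc: "(u, v) \<in> parcs P \<Longrightarrow> (\<phi> u, \<phi> v) \<in> parcs P"
  using endo by (auto simp: digraph_hom_def)

lemma coordinate_cases:
  assumes "u \<in> pverts P" "i \<in> I"
  obtains "u i = None" | x where "u i = Some x" "x \<in> pverts (G i)"
  using tensor_prod_vertD[OF assms] by (cases "u i") auto

lemma digon_iff:
  assumes "u \<in> pverts P" "v \<in> pverts P"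
  shows "(u, v) \<in> parcs P \<and> (v, u) \<in> parcs P \<longleftrightarrow> apexes v = I - apexes u"
proof -
  have "(u i, v i) \<in> parcs (cone (G i)) \<and> (v i, u i) \<in> parcs (cone (G i))
          \<longleftrightarrow> (u i = None \<longleftrightarrow> v i \<noteq> None)" if "i \<in> I" for i
    using oriented_cone_digon_iff[OF oriented[OF that]] tensor_prod_vertD[OF assms(1) that]
      tensor_prod_vertD[OF assms(2) that] by simp
  then have "(u, v) \<in> parcs P \<and> (v, u) \<in> parcs P \<longleftrightarrow> (\<forall>i\<in>I. u i = None \<longleftrightarrow> v i \<noteq> None)"
    using assms unfolding tensor_prod_arc_iff by blast
  also have "\<dots> \<longleftrightarrow> apexes v = I - apexes u"
    unfolding apexes_def set_eq_iff mem_Collect_eq Diff_iff Ball_def by metis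
  finally show ?thesis .
qed

lemma endo_complement:
  assumes "u \<in> pverts P" "v \<in> pverts P" "apexes v = I - apexes u"
  shows "apexes (\<phi> v) = I - apexes (\<phi> u)"
  using digon_iff[OF assms(1,2)] digon_iff[OF endo_vert endo_vert, OF assms(1,2)] assms(3) endo_arc
  by meson

definition apex_vertex :: "('i \<Rightarrow> 'a) \<Rightarrow> 'i set \<Rightarrow> ('i \<Rightarrow> 'a option)" where
  "apex_vertex f S = (\<lambda>i\<in>I. if i \<in> S then None else Some (f i))"

lemma apex_vertex_vert:
  "(\<And>i. i \<in> I - S \<Longrightarrow> f i \<in> pverts (G i)) \<Longrightarrow> apex_vertex f S \<in> pverts P"
  unfolding apex_vertex_def by (rule tensor_prod_vertI) simp

lemma apexes_apex_vertex [simp]: "apexes (apex_vertex f S) = I \<inter> S"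
  by (auto simp: apexes_def apex_vertex_def)

lemma apexes_subset: "apexes u \<subseteq> I"
  by (auto simp: apexes_def)

text \<open>Both \<open>u\<close> and \<open>v\<close> form a digon with one vertex
  \<open>w\<close>, and the image of \<open>w\<close> determines the apex sets of both
  images.\<close>

lemma endo_apexes_cong:
  assumes "u \<in> pverts P" "v \<in> pverts P" "apexes u = apexes v"
  shows "apexes (\<phi> u) = apexes (\<phi> v)"
proof -
  define w where "w = apex_vertex m (I - apexes u)"
  have w: "w \<in> pverts P" "apexes w = I - apexes u"
    unfolding w_def by (auto intro: apex_vertex_vert)
  then have "apexes (\<phi> w) = I - apexes (\<phi> u)" "apexes (\<phi> w) = I - apexes (\<phi> v)"
    using assms endo_complement by metis+
  then show ?thesis using apexes_subset[of "\<phi> u"] apexes_subset[of "\<phi> v"] by blast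
qed

lemma arc_apexes_disjoint: "(u, v) \<in> parcs P \<Longrightarrow> apexes u \<inter> apexes v = {}"
  by (force simp: tensor_prod_arc_iff apexes_def)

text \<open>Only the apex sets matter, so the other coordinates may be replaced by \<open>p\<close>
  and \<open>m\<close>; disjointness then yields an arc, which \<open>\<phi>\<close>
  preserves.\<close>

lemma endo_apexes_disjoint:
  assumes "u \<in> pverts P" "v \<in> pverts P" "apexes u \<inter> apexes v = {}"
  shows "apexes (\<phi> u) \<inter> apexes (\<phi> v) = {}"
proof -
  define u' v' where "u' = apex_vertex p (apexes u)" and "v' = apex_vertex m (apexes v)"
  have verts: "u' \<in> pverts P" "v' \<in> pverts P"
    unfolding u'_def v'_def by (auto intro: apex_vertex_vert)
  have "(u' i, v' i) \<in> parcs (cone (G i))" if "i \<in> I" for i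
    using that assms(3) arc_pm by (auto simp: u'_def v'_def apex_vertex_def)
  then have "(u', v') \<in> parcs P"
    using verts by (auto simp: tensor_prod_arc_iff)
  then have "apexes (\<phi> u') \<inter> apexes (\<phi> v') = {}"
    using endo_arc arc_apexes_disjoint by blast
  moreover have "apexes u' = apexes u" "apexes v' = apexes v"
    using apexes_subset by (auto simp: u'_def v'_def)
  ultimately show ?thesis
    using endo_apexes_cong verts assms(1,2) by metis
qed

text \<open>A set is empty iff it is disjoint from itself.\<close>

lemma endo_apexes_empty:
  assumes "u \<in> pverts P" "apexes u = {}"
  shows "apexes (\<phi> u) = {}"
  using endo_apexes_disjoint[OF assms(1) assms(1)] assms(2) by simp

text \<open>Otherwise the homomorphism from the product of the other factors to the cone, followed
  by \<open>\<phi>\<close>, would avoid the apex and so reach \<open>G i\<close> itself.\<close>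

lemma endo_apexes_singleton:
  assumes u: "u \<in> pverts P" "apexes u = {i}"
  shows "i \<in> apexes (\<phi> u)"
proof (rule ccontr)
  assume neg: "i \<notin> apexes (\<phi> u)"
  have i: "i \<in> I" using u apexes_subset by blast
  let ?Q = "tensor_prod (I - {i}) G"
  obtain h where h: "digraph_hom ?Q (cone (G i)) h"
    using hom_others_cone[OF i] unfolding hom_to_def by blast
  \<comment> \<open>\<open>q\<close> embeds the product of the other factors in \<open>P\<close> as
    the graph of \<open>h\<close>; only coordinate \<open>i\<close> can be an apex.\<close>
  define q where "q w = (\<lambda>j\<in>I. if j = i then h w else Some (w j))" for w
  have qv: "q w \<in> pverts P" if w: "w \<in> pverts ?Q" for w
    unfolding q_def
  proof (rule tensor_prod_vertI)
    fix j assume "j \<in> I"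
    then show "(if j = i then h w else Some (w j)) \<in> pverts (cone (G j))"
      using h w tensor_prod_vertD[OF w, of j] by (auto simp: digraph_hom_def)
  qed
  have qa: "(q w, q w') \<in> parcs P" if w: "(w, w') \<in> parcs ?Q" for w w'
  proof -
    have "(q w j, q w' j) \<in> parcs (cone (G j))" if "j \<in> I" for j
      using h w that by (auto simp: digraph_hom_def q_def tensor_prod_arc_iff)
    then show ?thesis using w qv by (auto simp: tensor_prod_arc_iff)
  qed
  have q_apex: "i \<notin> apexes (\<phi> (q w))" if w: "w \<in> pverts ?Q" for w
  proof -
    have "apexes (q w) \<subseteq> {i}" by (auto simp: q_def apexes_def split: if_splits)
    then consider "apexes (q w) = {}" | "apexes (q w) = apexes u"
      unfolding u(2) subset_singleton_iff by iprover
    then show ?thesis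
      using endo_apexes_empty endo_apexes_cong[OF qv[OF w] u(1)] qv[OF w] neg by cases auto
  qed
  have "digraph_hom ?Q (G i) (\<lambda>w. the (\<phi> (q w) i))"
    unfolding digraph_hom_def
  proof (intro conjI allI impI funcsetI)
    fix w assume w: "w \<in> pverts ?Q"
    show "the (\<phi> (q w) i) \<in> pverts (G i)"
      using endo_vert[OF qv[OF w]] i
      by (rule coordinate_cases) (use q_apex[OF w] i in \<open>auto simp: apexes_def\<close>)
  next
    fix w w' assume w: "(w, w') \<in> parcs ?Q"
    then have "w \<in> pverts ?Q" "w' \<in> pverts ?Q" by (auto simp: tensor_prod_arc_iff)
    then obtain x x' where "\<phi> (q w) i = Some x" "\<phi> (q w') i = Some x'"
      using q_apex[of w] q_apex[of w'] i by (auto simp: apexes_def)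
    then show "(the (\<phi> (q w) i), the (\<phi> (q w') i)) \<in> parcs (G i)"
      using endo_arc[OF qa[OF w]] i by (fastforce simp: tensor_prod_arc_iff)
  qed
  then show False using not_hom_others[OF i] unfolding hom_to_def by blast
qed

text \<open>For \<open>i\<close> in the apex set of \<open>u\<close>, the set \<open>{i}\<close> is
  disjoint from the complement of that set, and the images of the two stay disjoint.\<close>

lemma endo_apexes_increasing:
  assumes u: "u \<in> pverts P"
  shows "apexes u \<subseteq> apexes (\<phi> u)"
proof
  fix i assume i: "i \<in> apexes u"
  then have iI: "i \<in> I" using apexes_subset by blast
  define v w where "v = apex_vertex m {i}" and "w = apex_vertex m (I - apexes u)"
  have v: "v \<in> pverts P" "apexes v = {i}" and w: "w \<in> pverts P" "apexes w = I - apexes u"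
    unfolding v_def w_def using iI by (auto intro: apex_vertex_vert)
  have "apexes (\<phi> v) \<inter> apexes (\<phi> w) = {}"
    using endo_apexes_disjoint[OF v(1) w(1)] v(2) w(2) i by simp
  moreover have "i \<in> apexes (\<phi> v)" using endo_apexes_singleton v by blast
  moreover have "apexes (\<phi> w) = I - apexes (\<phi> u)" using endo_complement u w by blast
  ultimately show "i \<in> apexes (\<phi> u)" using iI by blast
qed

text \<open>Monotone growth applied to the complementary apex set gives the reverse
  inclusion.\<close>

lemma endo_apexes [simp]:
  assumes u: "u \<in> pverts P"
  shows "apexes (\<phi> u) = apexes u"
proof
  define w where "w = apex_vertex m (I - apexes u)"
  have w: "w \<in> pverts P" "apexes w = I - apexes u"
    unfolding w_def by (auto intro: apex_vertex_vert)
  then have "I - apexes u \<subseteq> I - apexes (\<phi> u)"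
    using endo_apexes_increasing[OF w(1)] endo_complement[OF u w] by simp
  then show "apexes (\<phi> u) \<subseteq> apexes u" using apexes_subset by blast
qed (rule endo_apexes_increasing[OF u])

lemma endo_None_iff:
  assumes "u \<in> pverts P" "i \<in> I"
  shows "\<phi> u i = None \<longleftrightarrow> u i = None"
  using endo_apexes[OF assms(1)] assms(2) unfolding apexes_def by blast

section \<open>Coordinates preserved by domination in a core\<close>

text \<open>When every arc of \<open>G i\<close> at \<open>x\<close> lifts to an arc between
  \<open>u\<close> and a vertex whose \<open>i\<close>-th coordinate is preserved, the new
  coordinate of \<open>u\<close> dominates \<open>x\<close>.\<close>

lemma endo_coordinate_eq:
  assumes u: "u \<in> pverts P" and i: "i \<in> I" "is_core (G i)" and x: "u i = Some x"
    and out: "\<And>y. (x, y) \<in> parcs (G i) \<Longrightarrow> \<exists>v. (u, v) \<in> parcs P \<and> v i = Some y \<and> \<phi> v i = v i"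
    and inn: "\<And>y. (y, x) \<in> parcs (G i) \<Longrightarrow> \<exists>v. (v, u) \<in> parcs P \<and> v i = Some y \<and> \<phi> v i = v i"
  shows "\<phi> u i = u i"
proof -
  obtain x' where x': "\<phi> u i = Some x'"
    using endo_None_iff[OF u i(1)] x by auto
  have "x \<in> pverts (G i)" "x' \<in> pverts (G i)"
    using tensor_prod_vertD[OF u i(1)] tensor_prod_vertD[OF endo_vert[OF u] i(1)] x x' by auto
  moreover have "(x', y) \<in> parcs (G i)" if "(x, y) \<in> parcs (G i)" for y
  proof -
    from out[OF that] obtain v where "(u, v) \<in> parcs P" "v i = Some y" "\<phi> v i = v i" by blast
    then show ?thesis using endo_arc[of u v] x' i(1) by (fastforce simp: tensor_prod_arc_iff)
  qed
  moreover have "(y, x') \<in> parcs (G i)" if "(y, x) \<in> parcs (G i)" for y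
  proof -
    from inn[OF that] obtain v where "(v, u) \<in> parcs P" "v i = Some y" "\<phi> v i = v i" by blast
    then show ?thesis using endo_arc[of v u] x' i(1) by (fastforce simp: tensor_prod_arc_iff)
  qed
  ultimately have "x' = x"
    using core_dominating_vertex_eq[OF pair_digraph_G[OF i(1)] i(2)] by blast
  then show ?thesis using x x' by simp
qed

end

section \<open>Fixed points of a retraction\<close>

locale cone_product_retraction = cone_product_endo I G \<phi> p m n
  for I :: "'i set" and G :: "'i \<Rightarrow> 'a pair_pre_digraph" and \<phi> p m n +
  assumes core: "\<And>i. i \<in> I \<Longrightarrow> is_core (G i)"
    and idem: "\<And>u. u \<in> pverts P \<Longrightarrow> \<phi> (\<phi> u) = \<phi> u"
    and orthogonal: "\<And>i f. i \<in> I \<Longrightarrow> digraph_hom (tensor_prod I G) (G i) f \<Longrightarrow>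
           f ` pverts (tensor_prod I G) = pverts (G i)"
begin

text \<open>Embedding the product of the \<open>G i\<close> in \<open>P\<close>, applying
  \<open>\<phi>\<close> and projecting to coordinate \<open>i\<close> is surjective by
  orthogonality; images under \<open>\<phi>\<close> are fixed by idempotence.\<close>

lemma fixed_vertex_over:
  assumes i: "i \<in> I" and x: "x \<in> pverts (G i)"
  obtains u where "u \<in> pverts P" "apexes u = {}" "u i = Some x" "\<phi> u = u"
proof -
  let ?Q = "tensor_prod I G"
  let ?s = "\<lambda>w. apex_vertex w {}"
  have sv: "?s w \<in> pverts P" if "w \<in> pverts ?Q" for w
    using tensor_prod_vertD[OF that] by (intro apex_vertex_vert) blast
  have s_Some: "\<phi> (?s w) i \<noteq> None" if w: "w \<in> pverts ?Q" for w
    using endo_None_iff[OF sv[OF w] i] i by (simp add: apex_vertex_def)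
  have "digraph_hom ?Q (G i) (\<lambda>w. the (\<phi> (?s w) i))"
    unfolding digraph_hom_def
  proof (intro conjI allI impI funcsetI)
    fix w assume w: "w \<in> pverts ?Q"
    show "the (\<phi> (?s w) i) \<in> pverts (G i)"
      using endo_vert[OF sv[OF w]] i by (rule coordinate_cases) (use s_Some[OF w] in auto)
  next
    fix w w' assume w: "(w, w') \<in> parcs ?Q"
    then have ww: "w \<in> pverts ?Q" "w' \<in> pverts ?Q" by (auto simp: tensor_prod_arc_iff)
    have "(?s w, ?s w') \<in> parcs P"
      using w sv by (auto simp: tensor_prod_arc_iff apex_vertex_def)
    then have "(\<phi> (?s w), \<phi> (?s w')) \<in> parcs P" by (rule endo_arc)
    then show "(the (\<phi> (?s w) i), the (\<phi> (?s w') i)) \<in> parcs (G i)"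
      using s_Some[OF ww(1)] s_Some[OF ww(2)] i by (fastforce simp: tensor_prod_arc_iff)
  qed
  then have "x \<in> (\<lambda>w. the (\<phi> (?s w) i)) ` pverts ?Q"
    using orthogonal[OF i] x by simp
  then obtain w where w: "w \<in> pverts ?Q" "the (\<phi> (?s w) i) = x"
    by (elim imageE) simp
  show thesis
  proof (rule that)
    show "\<phi> (?s w) \<in> pverts P" using endo_vert[OF sv[OF w(1)]] .
    show "apexes (\<phi> (?s w)) = {}" using endo_apexes[OF sv[OF w(1)]] by simp
    show "\<phi> (?s w) i = Some x" using w(2) s_Some[OF w(1)] by auto
    show "\<phi> (\<phi> (?s w)) = \<phi> (?s w)" using idem[OF sv[OF w(1)]] .
  qed
qed

definition axis :: "'i \<Rightarrow> 'a \<Rightarrow> ('i \<Rightarrow> 'a option)" where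
  "axis i x = apex_vertex (\<lambda>_. x) (I - {i})"

lemma axis_vert: "x \<in> pverts (G i) \<Longrightarrow> axis i x \<in> pverts P"
  unfolding axis_def by (rule apex_vertex_vert) auto

lemma axis_at: "i \<in> I \<Longrightarrow> axis i x i = Some x"
  by (simp add: axis_def apex_vertex_def)

lemma axis_arc:
  assumes "u \<in> pverts P" "apexes u = {}" "i \<in> I" "u i = Some x"
  shows "(x, y) \<in> parcs (G i) \<Longrightarrow> (u, axis i y) \<in> parcs P"
    and "(y, x) \<in> parcs (G i) \<Longrightarrow> (axis i y, u) \<in> parcs P"
proof -
  have "(u j, axis i y j) \<in> parcs (cone (G j)) \<and> (axis i y j, u j) \<in> parcs (cone (G j))"
    if "j \<in> I" "j \<noteq> i" for j
    using assms(1) that(1)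
    by (rule coordinate_cases)
      (use assms(2) that in \<open>auto simp: axis_def apex_vertex_def apexes_def\<close>)
  then show "(x, y) \<in> parcs (G i) \<Longrightarrow> (u, axis i y) \<in> parcs P"
    and "(y, x) \<in> parcs (G i) \<Longrightarrow> (axis i y, u) \<in> parcs P"
    unfolding tensor_prod_arc_iff
    using assms axis_vert arc_verts[OF assms(3)] axis_at[OF assms(3)] cone_arc_simps(4) by metis+
qed

lemma retraction_axis:
  assumes i: "i \<in> I" and x: "x \<in> pverts (G i)"
  shows "\<phi> (axis i x) = axis i x"
proof -
  define f where "f y = the (\<phi> (axis i y) i)" for y
  \<comment> \<open>Since \<open>\<phi>\<close> keeps apex sets, axis vertices go to axis
    vertices.\<close>
  have f: "\<phi> (axis i y) = axis i (f y) \<and> f y \<in> pverts (G i)" if y: "y \<in> pverts (G i)" for y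
  proof -
    note av = axis_vert[OF y]
    have S: "\<phi> (axis i y) i = Some (f y)"
      using endo_None_iff[OF av i] axis_at[OF i] by (auto simp: f_def)
    then have fy: "f y \<in> pverts (G i)"
      using tensor_prod_vertD[OF endo_vert[OF av] i] by simp
    have "\<phi> (axis i y) = axis i (f y)"
    proof (rule tensor_prod_vert_eqI[OF endo_vert[OF av] axis_vert[OF fy]])
      fix j assume j: "j \<in> I"
      show "\<phi> (axis i y) j = axis i (f y) j"
        using S endo_None_iff[OF av j] j by (cases "j = i") (auto simp: axis_def apex_vertex_def)
    qed
    then show ?thesis using fy by blast
  qed
  \<comment> \<open>A fixed apex-free vertex \<open>u\<close> over \<open>y\<close> is adjacent to
    \<open>axis i z\<close>; applying \<open>\<phi>\<close> moves only the second end of this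
    arc.\<close>
  have out: "(y, f z) \<in> parcs (G i)" if "(y, z) \<in> parcs (G i)" for y z
  proof -
    have yz: "y \<in> pverts (G i)" "z \<in> pverts (G i)" using arc_verts[OF i that] by auto
    obtain u where u: "u \<in> pverts P" "apexes u = {}" "u i = Some y" "\<phi> u = u"
      using fixed_vertex_over[OF i yz(1)] .
    have "(u, axis i (f z)) \<in> parcs P"
      using endo_arc[OF axis_arc(1)[OF u(1,2) i u(3) that]] u(4) f[OF yz(2)] by simp
    then show ?thesis using u(3) axis_at[OF i] i by (force simp: tensor_prod_arc_iff)
  qed
  have inn: "(f z, y) \<in> parcs (G i)" if "(z, y) \<in> parcs (G i)" for y z
  proof -
    have yz: "y \<in> pverts (G i)" "z \<in> pverts (G i)" using arc_verts[OF i that] by auto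
    obtain u where u: "u \<in> pverts P" "apexes u = {}" "u i = Some y" "\<phi> u = u"
      using fixed_vertex_over[OF i yz(1)] .
    have "(axis i (f z), u) \<in> parcs P"
      using endo_arc[OF axis_arc(2)[OF u(1,2) i u(3) that]] u(4) f[OF yz(2)] by simp
    then show ?thesis using u(3) axis_at[OF i] i by (force simp: tensor_prod_arc_iff)
  qed
  \<comment> \<open>Moving first the head of an arc by \<open>out\<close>, then its tail by
    \<open>inn\<close>, shows that \<open>f\<close> preserves arcs.\<close>
  have "digraph_hom (G i) (G i) f"
    unfolding digraph_hom_def using f out inn by blast
  moreover have "\<forall>y\<in>pverts (G i). f (f y) = f y"
    using f idem axis_vert axis_at[OF i] by (metis option.inject)
  ultimately have "f x = x" using core[OF i] x unfolding is_core_def by blast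
  then show ?thesis using f[OF x] by simp
qed

text \<open>First spreading step: the fixed axis vertices are the neighbours that lift the arcs at
  \<open>u i\<close>.\<close>

lemma retraction_no_apex:
  assumes u: "u \<in> pverts P" "apexes u = {}" and i: "i \<in> I"
  shows "\<phi> u i = u i"
proof -
  obtain x where x: "u i = Some x" using u(2) i by (auto simp: apexes_def)
  show ?thesis
    using endo_coordinate_eq[OF u(1) i core[OF i] x] axis_arc[OF u i x] axis_at[OF i]
      retraction_axis[OF i] arc_verts[OF i] by metis
qed

text \<open>With \<open>S\<close> the apex set of a vertex \<open>u\<close>, this vertex has apices
  exactly where \<open>u\<close> has none, apart from coordinate \<open>i\<close>.\<close>

definition middle :: "'i \<Rightarrow> 'a \<Rightarrow> 'i set \<Rightarrow> ('i \<Rightarrow> 'a option)" where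
  "middle i x S = apex_vertex (m(i := x)) (I - insert i S)"

lemma middle_vert: "x \<in> pverts (G i) \<Longrightarrow> middle i x S \<in> pverts P"
  unfolding middle_def by (rule apex_vertex_vert) auto

lemma middle_at: "i \<in> I \<Longrightarrow> middle i x S i = Some x"
  by (simp add: middle_def apex_vertex_def)

text \<open>
  Out-neighbours of \<open>u\<close> without apex coordinates exist only if no coordinate of \<open>u\<close> is a sink;
  filling up with the vertices \<open>m j\<close>, which are neither sinks nor sources, guarantees this.
\<close>

lemma retraction_middle:
  assumes i: "i \<in> I" and x: "x \<in> pverts (G i)"
  shows "\<phi> (middle i x S) i = middle i x S i"
proof (rule endo_coordinate_eq[OF middle_vert[OF x] i core[OF i] middle_at[OF i]])
  fix y assume y: "(x, y) \<in> parcs (G i)"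
  \<comment> \<open>Off \<open>i\<close>, each coordinate of \<open>middle i x S\<close> is
    \<open>m j\<close> or an apex, and both have \<open>n j\<close> as out-neighbour.\<close>
  let ?v = "apex_vertex (n(i := y)) {}"
  have v: "?v \<in> pverts P" using arc_verts[OF i y] by (auto intro: apex_vertex_vert)
  moreover have "(middle i x S, ?v) \<in> parcs P"
    using v middle_vert[OF x] y arc_mn arc_verts[OF i y]
    by (auto simp: tensor_prod_arc_iff middle_def apex_vertex_def)
  moreover have "\<phi> ?v i = ?v i" using retraction_no_apex[OF v _ i] by simp
  ultimately show "\<exists>v. (middle i x S, v) \<in> parcs P \<and> v i = Some y \<and> \<phi> v i = v i"
    using i by (intro exI[of _ ?v]) (simp add: apex_vertex_def)
next
  fix y assume y: "(y, x) \<in> parcs (G i)"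
  let ?v = "apex_vertex (p(i := y)) {}"
  have v: "?v \<in> pverts P" using arc_verts[OF i y] by (auto intro: apex_vertex_vert)
  moreover have "(?v, middle i x S) \<in> parcs P"
    using v middle_vert[OF x] y arc_pm arc_verts[OF i y]
    by (auto simp: tensor_prod_arc_iff middle_def apex_vertex_def)
  moreover have "\<phi> ?v i = ?v i" using retraction_no_apex[OF v _ i] by simp
  ultimately show "\<exists>v. (v, middle i x S) \<in> parcs P \<and> v i = Some y \<and> \<phi> v i = v i"
    using i by (intro exI[of _ ?v]) (simp add: apex_vertex_def)
qed

text \<open>Off coordinate \<open>i\<close> the apices are complementary, which gives arcs in both
  directions; only coordinate \<open>i\<close> decides.\<close>

lemma middle_arc:
  assumes u: "u \<in> pverts P" and i: "i \<in> I" "u i = Some x"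
  shows "(x, y) \<in> parcs (G i) \<Longrightarrow> (u, middle i y (apexes u)) \<in> parcs P"
    and "(y, x) \<in> parcs (G i) \<Longrightarrow> (middle i y (apexes u), u) \<in> parcs P"
proof -
  have "(u j, middle i y (apexes u) j) \<in> parcs (cone (G j)) \<and>
        (middle i y (apexes u) j, u j) \<in> parcs (cone (G j))" if "j \<in> I" "j \<noteq> i" for j
    using u that(1)
    by (rule coordinate_cases) (use that in \<open>auto simp: middle_def apex_vertex_def apexes_def\<close>)
  then show "(x, y) \<in> parcs (G i) \<Longrightarrow> (u, middle i y (apexes u)) \<in> parcs P"
    and "(y, x) \<in> parcs (G i) \<Longrightarrow> (middle i y (apexes u), u) \<in> parcs P"
    unfolding tensor_prod_arc_iff
    using u i middle_vert arc_verts[OF i(1)] middle_at[OF i(1)] cone_arc_simps(4) by metis+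
qed

text \<open>Last spreading step: the vertices \<open>middle i y (apexes u)\<close> serve as
  neighbours of an arbitrary \<open>u\<close>.\<close>

lemma retraction_eq:
  assumes u: "u \<in> pverts P"
  shows "\<phi> u = u"
proof (rule tensor_prod_vert_eqI[OF endo_vert[OF u] u])
  fix i assume i: "i \<in> I"
  show "\<phi> u i = u i"
  proof (cases "u i")
    case None
    then show ?thesis using endo_None_iff[OF u i] by simp
  next
    case (Some x)
    show ?thesis
      using endo_coordinate_eq[OF u i core[OF i] Some] middle_arc[OF u i Some] middle_at[OF i]
        retraction_middle[OF i] arc_verts[OF i] by metis
  qed
qed

end

section \<open>The product of the cones is a core\<close>

theorem theorem37:
  fixes I :: "'i set" and G :: "'i \<Rightarrow> 'a pair_pre_digraph"
  assumes "finite I"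
    and "\<And>i. i \<in> I \<Longrightarrow> oriented_graph (G i)"
    and "\<And>i. i \<in> I \<Longrightarrow> is_core (G i)"
    and "\<And>i j. i \<in> I \<Longrightarrow> j \<in> I \<Longrightarrow> i \<noteq> j \<Longrightarrow> incomparable (G i) (G j)"
    and "\<And>i. i \<in> I \<Longrightarrow> \<not> hom_to (tensor_prod (I - {i}) G) (G i)"
    and "\<And>i. i \<in> I \<Longrightarrow> hom_to (tensor_prod (I - {i}) G) (cone (G i))"
    and "\<And>i f. i \<in> I \<Longrightarrow> digraph_hom (tensor_prod I G) (G i) f \<Longrightarrow>
           f ` pverts (tensor_prod I G) = pverts (G i)"
  shows "is_core (tensor_prod I (\<lambda>i. cone (G i)))"
proof -
  have pd: "pair_digraph (G i)" if "i \<in> I" for i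
    using assms(2)[OF that] oriented_graph.axioms(1) by blast
  have middle: "\<exists>x y z. (x, y) \<in> parcs (G i) \<and> (y, z) \<in> parcs (G i)" if i: "i \<in> I" for i
  proof -
    \<comment> \<open>A second member of the family is needed for incomparability to give a walk of
      length two in \<open>G i\<close>.\<close>
    have "I \<noteq> {i}"
    proof
      \<comment> \<open>The empty product has a loop.\<close>
      assume "I = {i}"
      then obtain h where "digraph_hom (tensor_prod {} G) (cone (G i)) h"
        using assms(6)[OF i] by (auto simp: hom_to_def)
      then have loop: "(h (\<lambda>_. undefined), h (\<lambda>_. undefined)) \<in> parcs (cone (G i))"
        by (simp add: digraph_hom_def tensor_prod_def)
      interpret pair_digraph "cone (G i)"
        using pd[OF i] by (rule pair_digraph_cone)
      show False using pair_no_loops[OF loop] by simp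
    qed
    then obtain j where "j \<in> I" "j \<noteq> i" using i by blast
    then show ?thesis
      using incomparable_middle_vertex[OF pd[OF i] pd] assms(4) i by metis
  qed
  then obtain p m n where pm: "\<And>i. i \<in> I \<Longrightarrow> (p i, m i) \<in> parcs (G i)"
    and mn: "\<And>i. i \<in> I \<Longrightarrow> (m i, n i) \<in> parcs (G i)"
    by metis
  show ?thesis
    unfolding is_core_def
  proof (intro allI impI ballI)
    let ?P = "tensor_prod I (\<lambda>i. cone (G i))"
    fix \<phi> u
    assume \<phi>: "digraph_hom ?P ?P \<phi> \<and> (\<forall>v\<in>pverts ?P. \<phi> (\<phi> v) = \<phi> v)" and u: "u \<in> pverts ?P"
    have idem: "\<And>v. v \<in> pverts ?P \<Longrightarrow> \<phi> (\<phi> v) = \<phi> v" using \<phi> by blast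
    interpret cone_product_retraction I G \<phi> p m n
      by (intro cone_product_retraction.intro cone_product_endo.intro
          cone_product_retraction_axioms.intro) (fact assms pm mn conjunct1[OF \<phi>] idem)+
    show "\<phi> u = u" using u by (rule retraction_eq)
  qed
qed

end
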